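(* Let $(\mathcal{F}=\mathcal{F}^{+}\dot{+}\mathcal{F}^{-},\psi,\mathcal{J})$ be a standardized two-Krein space, let $t\in\mathcal{F}$ be fixed with $t=t^{+}+t^{-}$, let $v\in\mathcal{F}$, let $f,g:[a,b]\to\mathcal{F}$ be strongly of bounded $t$-variation over $[a,b]$, and let $\alpha\in\mathbb{C}$. Then: (1) $V_{a}^{b}(\alpha f,\mathcal{F},t)_{\mathcal{J}}=|\alpha|\,V_{a}^{b}(f,\mathcal{F},t)_{\mathcal{J}}$; (2) $V_{a}^{b}(f+g,\mathcal{F},t)_{\mathcal{J}}\le V_{a}^{b}(f,\mathcal{F},t)_{\mathcal{J}}+V_{a}^{b}(g,\mathcal{F},t)_{\mathcal{J}}$ and $V_{a}^{b}(f,\mathcal{F},t+v)_{\mathcal{J}}\le V_{a}^{b}(f,\mathcal{F},t)_{\mathcal{J}}+V_{a}^{b}(f,\mathcal{F},v)_{\mathcal{J}}$; (3) $V_{a}^{b}(f,\mathcal{F},t)_{\mathcal{J}}\le \overset{+}{V}{}_{a}^{b}(f^{+},\mathcal{F}^{+},t^{+})_{\mathcal{J}}+\overset{-}{V}{}_{a}^{b}(f^{-},\mathcal{F}^{-},t^{-})_{\mathcal{J}}$.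
   Context: A Krein space is a pair $(\mathcal{F},[\cdot,\cdot])$ where $\mathcal{F}$ is a complex vector space and $[\cdot,\cdot]$ is an indefinite inner product (a Hermitian sesquilinear form, linear in the first variable) admitting a direct sum decomposition $\mathcal{F}=\mathcal{F}^{+}\dot{+}\mathcal{F}^{-}$ into mutually $[\cdot,\cdot]$-orthogonal subspaces (a fundamental decomposition) such that $(\mathcal{F}^{+},[\cdot,\cdot])$ and $(\mathcal{F}^{-},-[\cdot,\cdot])$ are Hilbert spaces. Each $x\in\mathcal{F}$ is written $x=x^{+}+x^{-}$ with $x^{\pm}\in\mathcal{F}^{\pm}$; the fundamental symmetry is $\mathcal{J}x=x^{+}-x^{-}$; $\|x^{+}\|_{+}=\sqrt{[x^{+},x^{+}]}$, $\|x^{-}\|_{-}=\sqrt{-[x^{-},x^{-}]}$. A standardized two-Krein space $(\mathcal{F},\psi,\mathcal{J})$ is such a Krein space, of dimension at least $2$, equipped with $\psi(x,y,z)=[x^{+},y^{+}]\|z^{+}\|_{+}^{2}+[x^{-},y^{-}]\|z^{-}\|_{-}^{2}$. Its $\mathcal{J}$-two-norm is $\mathcal{N}_{\mathcal{J}}(x,y)=\sqrt{\psi(\mathcal{J}x,x,y)}$. The two-norms on $\mathcal{F}^{\pm}$ are $\mathcal{N}^{+}(x^{+},y^{+})=\|x^{+}\|_{+}\|y^{+}\|_{+}$ and $\mathcal{N}^{-}(x^{-},y^{-})=\|x^{-}\|_{-}\|y^{-}\|_{-}$. Let $\mathcal{P}[a,b]$ be the set of finite partitions $a=x_0<x_1<\dots<x_n=b$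 of the closed interval $[a,b]$. For $f:[a,b]\to\mathcal{F}$ and $t\in\mathcal{F}$, the $t$-variation is $V_{a}^{b}(f,\mathcal{F},t)_{\mathcal{J}}=\sup_{P\in\mathcal{P}[a,b]}\sum_{i=1}^{n}\mathcal{N}_{\mathcal{J}}(f(x_i)-f(x_{i-1}),t)\in[0,\infty]$, and $f$ is strongly of bounded $t$-variation if this is finite. Write $f(x)=f^{+}(x)+f^{-}(x)$ with $f^{\pm}(x)\in\mathcal{F}^{\pm}$, and $\overset{\pm}{V}{}_{a}^{b}(f^{\pm},\mathcal{F}^{\pm},t^{\pm})_{\mathcal{J}}=\sup_{P\in\mathcal{P}[a,b]}\sum_{i=1}^{n}\mathcal{N}^{\pm}(f^{\pm}(x_i)-f^{\pm}(x_{i-1}),t^{\pm})$. *)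

theory Defs
  imports "HOL-Analysis.Analysis"
begin

text \<open>
  Complex vector spaces are rendered by the library locale \<^locale>\<open>vector_space\<close> over the field of
  complex numbers; the whole type \<^typ>\<open>'a\<close> is the underlying space.  No definiteness of the inner
  product is assumed: ``indefinite'' means ``not necessarily definite''.
\<close>

locale indefinite_inner_product_space = vector_space smul
  for smul :: "complex \<Rightarrow> 'a::ab_group_add \<Rightarrow> 'a" +
  fixes ip :: "'a \<Rightarrow> 'a \<Rightarrow> complex"
  assumes ip_add_left: "ip (x + y) z = ip x z + ip y z"
    and ip_scale_left: "ip (smul c x) z = c * ip x z"
    and ip_hermitian: "ip y x = cnj (ip x y)"

text \<open>Squares \<open>[x, x]\<close> are real by hermitian symmetry, so taking real parts below loses nothing.\<close>

definition ip_norm :: "('a \<Rightarrow> 'a \<Rightarrow> complex) \<Rightarrow> 'a \<Rightarrow> real"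
  where "ip_norm ip x = sqrt (Re (ip x x))"

text \<open>To be used for hermitian sesquilinear \<open>ip\<close>.\<close>

definition hilbert_subspace ::
  "(complex \<Rightarrow> 'a::ab_group_add \<Rightarrow> 'a) \<Rightarrow> ('a \<Rightarrow> 'a \<Rightarrow> complex) \<Rightarrow> 'a set \<Rightarrow> bool"
  where "hilbert_subspace smul ip S \<longleftrightarrow>
    module.subspace smul S \<and>
    (\<forall>x\<in>S. x \<noteq> 0 \<longrightarrow> 0 < Re (ip x x)) \<and>
    Metric_space.mcomplete S (\<lambda>x y. ip_norm ip (x - y))"

definition fundamental_decomposition ::
  "(complex \<Rightarrow> 'a::ab_group_add \<Rightarrow> 'a) \<Rightarrow> ('a \<Rightarrow> 'a \<Rightarrow> complex) \<Rightarrow> 'a set \<Rightarrow> 'a set \<Rightarrow> bool"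
  where "fundamental_decomposition smul ip Fp Fm \<longleftrightarrow>
    module.subspace smul Fp \<and> module.subspace smul Fm \<and>
    (\<forall>x. \<exists>u\<in>Fp. \<exists>w\<in>Fm. x = u + w) \<and> Fp \<inter> Fm = {0} \<and>
    (\<forall>u\<in>Fp. \<forall>w\<in>Fm. ip u w = 0) \<and>
    hilbert_subspace smul ip Fp \<and>
    hilbert_subspace smul (\<lambda>x y. - ip x y) Fm"

locale krein_space = indefinite_inner_product_space smul ip
  for smul :: "complex \<Rightarrow> 'a::ab_group_add \<Rightarrow> 'a" and ip :: "'a \<Rightarrow> 'a \<Rightarrow> complex" +
  assumes ex_fundamental_decomposition: "\<exists>Fp Fm. fundamental_decomposition smul ip Fp Fm"

text \<open>
  The component of \<open>x\<close> in \<open>S\<close> along \<open>T\<close>, for a direct sum decomposition into \<open>S\<close> and \<open>T\<close>.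
  Thus \<open>component Fp Fm x\<close> is $x^+$ and \<open>component Fm Fp x\<close> is $x^-$.
\<close>

definition component :: "'a::ab_group_add set \<Rightarrow> 'a set \<Rightarrow> 'a \<Rightarrow> 'a"
  where "component S T x = (THE u. u \<in> S \<and> (\<exists>w\<in>T. x = u + w))"

definition fundamental_symmetry :: "'a::ab_group_add set \<Rightarrow> 'a set \<Rightarrow> 'a \<Rightarrow> 'a"
  where "fundamental_symmetry Fp Fm x = component Fp Fm x - component Fm Fp x"

definition standard_two_inner_product ::
  "('a \<Rightarrow> 'a \<Rightarrow> complex) \<Rightarrow> 'a::ab_group_add set \<Rightarrow> 'a set \<Rightarrow> 'a \<Rightarrow> 'a \<Rightarrow> 'a \<Rightarrow> complex"
  where "standard_two_inner_product ip Fp Fm x y z =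
    ip (component Fp Fm x) (component Fp Fm y)
        * of_real ((ip_norm ip (component Fp Fm z))\<^sup>2)
    + ip (component Fm Fp x) (component Fm Fp y)
        * of_real ((ip_norm (\<lambda>u w. - ip u w) (component Fm Fp z))\<^sup>2)"

locale standardized_two_krein_space = krein_space smul ip
  for smul :: "complex \<Rightarrow> 'a::ab_group_add \<Rightarrow> 'a" and ip :: "'a \<Rightarrow> 'a \<Rightarrow> complex" +
  fixes Fp Fm :: "'a set"
    and \<psi> :: "'a \<Rightarrow> 'a \<Rightarrow> 'a \<Rightarrow> complex"
    and \<J> :: "'a \<Rightarrow> 'a"
  assumes decomposition: "fundamental_decomposition smul ip Fp Fm"
    and dim_ge_2: "\<exists>B. independent B \<and> card B = 2"
    and psi_eq: "\<psi> = standard_two_inner_product ip Fp Fm"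
    and J_eq: "\<J> = fundamental_symmetry Fp Fm"

text \<open>
  In a standardized two-Krein space,
  $\psi(\mathcal{J}x,x,y) = \|x^+\|_+^2 \|y^+\|_+^2 + \|x^-\|_-^2 \|y^-\|_-^2$ is real and nonnegative.
\<close>

definition J_two_norm :: "('a \<Rightarrow> 'a \<Rightarrow> 'a \<Rightarrow> complex) \<Rightarrow> ('a \<Rightarrow> 'a) \<Rightarrow> 'a \<Rightarrow> 'a \<Rightarrow> real"
  where "J_two_norm \<psi> \<J> x y = sqrt (Re (\<psi> (\<J> x) x y))"

text \<open>
  The two-norm of a Hilbert space; with \<open>ip\<close> it is $\mathcal{N}^+$, with the negated
  \<open>ip\<close> it is $\mathcal{N}^-$.
\<close>

definition hilbert_two_norm :: "('a \<Rightarrow> 'a \<Rightarrow> complex) \<Rightarrow> 'a \<Rightarrow> 'a \<Rightarrow> real"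
  where "hilbert_two_norm ip x y = ip_norm ip x * ip_norm ip y"

text \<open>
  A pair \<open>(n, x)\<close> stands for the partition \<open>a = x 0 < \<dots> < x n = b\<close>; the values of \<open>x\<close> beyond \<open>n\<close>
  are irrelevant.  For \<open>a = b\<close> only \<open>n = 0\<close> occurs.
\<close>

definition partitions :: "real \<Rightarrow> real \<Rightarrow> (nat \<times> (nat \<Rightarrow> real)) set"
  where "partitions a b = {(n, x). x 0 = a \<and> x n = b \<and> (\<forall>i<n. x i < x (Suc i))}"

text \<open>
  The variation over \<open>[a, b]\<close> with respect to a two-norm \<open>N\<close>; only the values of \<open>f\<close> on \<open>[a, b]\<close>
  enter.
\<close>

definition variation ::
  "('a \<Rightarrow> 'a \<Rightarrow> real) \<Rightarrow> real \<Rightarrow> real \<Rightarrow> (real \<Rightarrow> 'a::ab_group_add) \<Rightarrow> 'a \<Rightarrow> ennreal"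
  where "variation N a b f t =
    (SUP (n, x) \<in> partitions a b. ennreal (\<Sum>i=1..n. N (f (x i) - f (x (i - 1))) t))"

definition strongly_bounded_variation ::
  "('a \<Rightarrow> 'a \<Rightarrow> real) \<Rightarrow> real \<Rightarrow> real \<Rightarrow> (real \<Rightarrow> 'a::ab_group_add) \<Rightarrow> 'a \<Rightarrow> bool"
  where "strongly_bounded_variation N a b f t \<longleftrightarrow> variation N a b f t < \<infinity>"

end

theory Submission
  imports Defs
begin

text \<open>
  Along a direct sum decomposition both projections \<open>x \<mapsto> x\<^sup>+\<close> and \<open>x \<mapsto> x\<^sup>-\<close> are linear, and on each
  summand the (suitably signed) form is positive definite, so by the Cauchy--Schwarz inequality
  \<open>x \<mapsto> \<parallel>x\<^sup>+\<parallel>\<^sub>+\<close> and \<open>x \<mapsto> \<parallel>x\<^sup>-\<parallel>\<^sub>-\<close> are seminorms on the whole space.  The fundamental symmetry flips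
  the sign of \<open>[x\<^sup>-, x\<^sup>-]\<close> and turns the defining expression into
  \<open>\<N>\<^sub>J(x, y) = sqrt ((\<parallel>x\<^sup>+\<parallel>\<^sub>+ \<parallel>y\<^sup>+\<parallel>\<^sub>+)\<^sup>2 + (\<parallel>x\<^sup>-\<parallel>\<^sub>- \<parallel>y\<^sup>-\<parallel>\<^sub>-)\<^sup>2)\<close>, the Euclidean length of the pair
  \<open>(\<N>\<^sup>+(x\<^sup>+, y\<^sup>+), \<N>\<^sup>-(x\<^sup>-, y\<^sup>-))\<close> (lemma \<open>J_two_norm_eq\<close>).  This expression is symmetric in \<open>x\<close> and \<open>y\<close>,
  is absolutely homogeneous and, by Minkowski's inequality in the plane, subadditive in each
  argument; and it is at most the sum of the two coordinates.

  Every claim on variations is one of these pointwise facts applied to the increments of \<open>f\<close>, which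
  depend linearly on \<open>f\<close>, then summed over a partition and taken to the supremum.  The passage from
  increments to variations for the three inequalities is \<open>variation_le_add\<close>.
\<close>

section \<open>Variation and pointwise estimates of increments\<close>

lemma variation_le_add:
  assumes le: "\<And>r s. N (f r - f s) t \<le> N\<^sub>1 (g r - g s) u + N\<^sub>2 (h r - h s) v"
    and nonneg: "\<And>x y. 0 \<le> N\<^sub>1 x y" "\<And>x y. 0 \<le> N\<^sub>2 x y"
  shows "variation N a b f t \<le> variation N\<^sub>1 a b g u + variation N\<^sub>2 a b h v"
  unfolding variation_def[of N]
proof (rule SUP_least, clarify)
  fix n and x :: "nat \<Rightarrow> real"
  assume P: "(n, x) \<in> partitions a b"
  let ?S = "\<Sum>i=1..n. N (f (x i) - f (x (i - 1))) t"
  let ?S\<^sub>1 = "\<Sum>i=1..n. N\<^sub>1 (g (x i) - g (x (i - 1))) u"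
  let ?S\<^sub>2 = "\<Sum>i=1..n. N\<^sub>2 (h (x i) - h (x (i - 1))) v"
  have "?S \<le> ?S\<^sub>1 + ?S\<^sub>2"
    unfolding sum.distrib[symmetric] by (intro sum_mono le)
  then have "ennreal ?S \<le> ennreal (?S\<^sub>1 + ?S\<^sub>2)"
    by (rule ennreal_leI)
  also have "\<dots> = ennreal ?S\<^sub>1 + ennreal ?S\<^sub>2"
    by (intro ennreal_plus sum_nonneg nonneg)
  also have "ennreal ?S\<^sub>1 \<le> variation N\<^sub>1 a b g u"
    unfolding variation_def by (rule SUP_upper2[OF P]) simp
  also have "ennreal ?S\<^sub>2 \<le> variation N\<^sub>2 a b h v"
    unfolding variation_def by (rule SUP_upper2[OF P]) simp
  finally show "ennreal ?S \<le> variation N\<^sub>1 a b g u + variation N\<^sub>2 a b h v"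
    by (simp add: add_left_mono add_right_mono)
qed

lemma variation_scale:
  assumes eq: "\<And>r s. N (g r - g s) t = c * N (f r - f s) t" and "0 \<le> c"
  shows "variation N a b g t = ennreal c * variation N a b f t"
proof -
  have "variation N a b g t
      = (SUP (n, x) \<in> partitions a b. ennreal c * ennreal (\<Sum>i=1..n. N (f (x i) - f (x (i - 1))) t))"
    unfolding variation_def using \<open>0 \<le> c\<close>
    by (simp add: eq sum_distrib_left[symmetric] ennreal_mult')
  then show ?thesis
    by (simp add: variation_def SUP_mult_left_ennreal case_prod_unfold)
qed

section \<open>Projections along a direct sum\<close>

locale direct_sum = vector_space scale
  for scale :: "'a::field \<Rightarrow> 'b::ab_group_add \<Rightarrow> 'b" (infixr \<open>*s\<close> 75) +
  fixes S T :: "'b set"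
  assumes subspace_S: "subspace S"
    and subspace_T: "subspace T"
    and inter: "S \<inter> T = {0}"
    and decompose: "\<exists>u\<in>S. \<exists>w\<in>T. x = u + w"
begin

lemma swap: "direct_sum scale T S"
proof unfold_locales
  fix x
  obtain u w where "u \<in> S" "w \<in> T" "x = u + w"
    using decompose by blast
  then show "\<exists>u\<in>T. \<exists>w\<in>S. x = u + w"
    by (intro bexI[of _ w] bexI[of _ u]) (simp_all add: add.commute)
qed (use inter subspace_S subspace_T in auto)

lemma component_eqI:
  assumes "u \<in> S" "w \<in> T" "x = u + w"
  shows "component S T x = u"
  unfolding component_def
proof (rule the_equality)
  show "u \<in> S \<and> (\<exists>w\<in>T. x = u + w)"
    by (intro conjI bexI[of _ w] assms)
next
  fix u' assume "u' \<in> S \<and> (\<exists>w\<in>T. x = u' + w)"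
  then obtain w' where *: "u' \<in> S" "w' \<in> T" "u + w = u' + w'"
    unfolding \<open>x = u + w\<close> by blast
  have "u' - u = w - w'"
    using *(3) by (simp add: algebra_simps)
  moreover have "u' - u \<in> S" "w - w' \<in> T"
    using * assms subspace_S subspace_T by (auto intro: subspace_diff)
  ultimately have "u' - u \<in> S \<inter> T"
    by simp
  then show "u' = u"
    by (simp add: inter)
qed

lemma component_cases:
  obtains u w where "u \<in> S" "w \<in> T" "x = u + w" "component S T x = u" "component T S x = w"
proof -
  obtain u w where *: "u \<in> S" "w \<in> T" "x = u + w"
    using decompose by blast
  have "component T S x = w"
    using * by (intro direct_sum.component_eqI[OF swap, of w u]) (simp_all add: add.commute)
  then show thesis
    by (intro that[OF * component_eqI[OF *]])
qed

lemma component_in: "component S T x \<in> S"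
  by (rule component_cases[of x]) simp

lemma component_add: "component S T (x + y) = component S T x + component S T y"
proof -
  obtain u w where x: "u \<in> S" "w \<in> T" "x = u + w" "component S T x = u"
    by (rule component_cases)
  obtain u' w' where y: "u' \<in> S" "w' \<in> T" "y = u' + w'" "component S T y = u'"
    by (rule component_cases)
  have "component S T (x + y) = u + u'"
    using x y subspace_S subspace_T
    by (intro component_eqI[where w = "w + w'"]) (auto simp: algebra_simps intro: subspace_add)
  then show ?thesis
    using x y by simp
qed

lemma component_scale: "component S T (c *s x) = c *s component S T x"
proof -
  obtain u w where x: "u \<in> S" "w \<in> T" "x = u + w" "component S T x = u"
    by (rule component_cases)
  have "component S T (c *s x) = c *s u"
    using x subspace_S subspace_T
    by (intro component_eqI[where w = "c *s w"])
      (auto simp: scale_right_distrib intro: subspace_scale)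
  then show ?thesis
    using x by simp
qed

lemma component_diff: "component S T (x - y) = component S T x - component S T y"
  using component_add[of "x - y" y] by simp

end

section \<open>The norm on a positive definite subspace\<close>

context indefinite_inner_product_space
begin

lemma ip_add_right: "ip x (y + z) = ip x y + ip x z"
  using ip_hermitian[of x "y + z"] ip_hermitian[of x y] ip_hermitian[of x z]
  by (simp add: ip_add_left)

lemma ip_scale_right: "ip x (smul c y) = cnj c * ip x y"
  using ip_hermitian[of x "smul c y"] ip_hermitian[of x y] by (simp add: ip_scale_left)

lemma ip_self_real: "Im (ip x x) = 0"
  using ip_hermitian[of x x] by (metis Reals_cnj_iff complex_is_Real_iff)

lemma ip_zero_left [simp]: "ip 0 x = 0"
  using ip_add_left[of 0 0 x] by simp

lemma ip_zero_right [simp]: "ip x 0 = 0"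
  using ip_add_right[of x 0 0] by simp

lemma ip_minus_left: "ip (- x) y = - ip x y"
  using ip_add_left[of x "- x" y] by (simp add: eq_neg_iff_add_eq_0 add.commute)

text \<open>This transfers what is proved for the norm on \<open>\<F>\<^sup>+\<close> to the norm on \<open>\<F>\<^sup>-\<close>.\<close>

lemma negated_ip: "indefinite_inner_product_space smul (\<lambda>x y. - ip x y)"
proof unfold_locales
  fix x y show "- ip y x = cnj (- ip x y)"
    using ip_hermitian[of y x] by simp
qed (simp_all add: ip_add_left ip_scale_left)

lemma ip_self_nonneg:
  assumes "hilbert_subspace smul ip S" "x \<in> S"
  shows "0 \<le> Re (ip x x)"
  using assms by (cases "x = 0") (auto simp: hilbert_subspace_def less_imp_le)

lemma ip_norm_nonneg:
  assumes "hilbert_subspace smul ip S" "x \<in> S"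
  shows "0 \<le> ip_norm ip x"
  using ip_self_nonneg[OF assms] by (simp add: ip_norm_def)

lemma ip_norm_scale: "ip_norm ip (smul c x) = cmod c * ip_norm ip x"
proof -
  have "ip (smul c x) (smul c x) = (c * cnj c) * ip x x"
    by (simp add: ip_scale_left ip_scale_right)
  also have "c * cnj c = of_real ((cmod c)\<^sup>2)"
    by (rule complex_norm_square[symmetric])
  finally show ?thesis
    by (simp add: ip_norm_def real_sqrt_mult del: of_real_power)
qed

text \<open>
  Only the real part is bounded here; that suffices for the triangle inequality, and it lets the
  proof work with real multiples of the two vectors.
\<close>

lemma Re_ip_le_ip_norm:
  assumes S: "hilbert_subspace smul ip S" and "x \<in> S" "y \<in> S"
  shows "Re (ip x y) \<le> ip_norm ip x * ip_norm ip y"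
proof (cases "y = 0")
  case True
  then show ?thesis
    by (simp add: ip_norm_def)
next
  case False
  define A where "A = Re (ip x x)"
  define B where "B = Re (ip y y)"
  define R where "R = Re (ip x y)"
  have "0 < B"
    using False assms by (simp add: B_def hilbert_subspace_def)
  have R': "Re (ip y x) = R"
    using ip_hermitian[of y x] by (simp add: R_def)
  \<comment> \<open>Up to the factor \<open>B\<close>, the vector \<open>z\<close> is \<open>x\<close> minus its projection onto \<open>y\<close>; this form avoids
    dividing.\<close>
  define z where "z = smul (of_real B) x + smul (of_real (- R)) y"
  have "z \<in> S"
    using assms unfolding z_def hilbert_subspace_def
    by (auto intro!: subspace_diff subspace_scale)
  have "Re (ip z z) = B * (A * B - R\<^sup>2)"
    unfolding z_def
    by (simp add: ip_add_left ip_add_right ip_scale_left ip_scale_right ip_self_real R'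
        A_def[symmetric] B_def[symmetric] R_def[symmetric] power2_eq_square algebra_simps
        del: of_real_minus)
  with ip_self_nonneg[OF S \<open>z \<in> S\<close>] \<open>0 < B\<close> have "R\<^sup>2 \<le> A * B"
    by (simp add: zero_le_mult_iff)
  then have "\<bar>R\<bar> \<le> sqrt (A * B)"
    by (metis real_sqrt_abs real_sqrt_le_mono)
  then show ?thesis
    by (simp add: ip_norm_def real_sqrt_mult A_def B_def R_def)
qed

lemma ip_norm_triangle:
  assumes S: "hilbert_subspace smul ip S" and x: "x \<in> S" and y: "y \<in> S"
  shows "ip_norm ip (x + y) \<le> ip_norm ip x + ip_norm ip y"
proof -
  have "Re (ip y x) = Re (ip x y)"
    using ip_hermitian[of y x] by simp
  then have "Re (ip (x + y) (x + y)) = Re (ip x x) + Re (ip y y) + 2 * Re (ip x y)"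
    by (simp add: ip_add_left ip_add_right)
  also have "\<dots> \<le> (ip_norm ip x)\<^sup>2 + (ip_norm ip y)\<^sup>2 + 2 * (ip_norm ip x * ip_norm ip y)"
    using Re_ip_le_ip_norm[OF assms] ip_self_nonneg[OF S x] ip_self_nonneg[OF S y]
    by (simp add: ip_norm_def)
  also have "\<dots> = (ip_norm ip x + ip_norm ip y)\<^sup>2"
    by (simp add: power2_sum)
  finally have "sqrt (Re (ip (x + y) (x + y))) \<le> sqrt ((ip_norm ip x + ip_norm ip y)\<^sup>2)"
    by (rule real_sqrt_le_mono)
  then show ?thesis
    using ip_norm_nonneg[OF S x] ip_norm_nonneg[OF S y] by (simp add: ip_norm_def)
qed

text \<open>The seminorm on the whole space obtained by projecting onto a Hilbert summand.\<close>

lemma component_seminorm: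
  assumes ds: "direct_sum smul S T" and S: "hilbert_subspace smul ip S"
  shows "0 \<le> ip_norm ip (component S T x)"
    and "ip_norm ip (component S T (smul c x)) = cmod c * ip_norm ip (component S T x)"
    and "ip_norm ip (component S T (x + y))
           \<le> ip_norm ip (component S T x) + ip_norm ip (component S T y)"
  using S direct_sum.component_in[OF ds]
  by (auto simp: direct_sum.component_add[OF ds] direct_sum.component_scale[OF ds] ip_norm_scale
      intro: ip_norm_nonneg ip_norm_triangle)

end

section \<open>The two-norm of a standardized two-Krein space\<close>

context standardized_two_krein_space
begin

lemma direct_sum_Fp_Fm: "direct_sum smul Fp Fm"
  using decomposition by unfold_locales (simp_all add: fundamental_decomposition_def)

lemmas direct_sum_Fm_Fp = direct_sum.swap[OF direct_sum_Fp_Fm]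

definition pos_norm :: "'a \<Rightarrow> real"
  where "pos_norm x = ip_norm ip (component Fp Fm x)"

definition neg_norm :: "'a \<Rightarrow> real"
  where "neg_norm x = ip_norm (\<lambda>x y. - ip x y) (component Fm Fp x)"

lemma pos_norm_seminorm:
  shows pos_norm_nonneg: "0 \<le> pos_norm x"
    and pos_norm_scale: "pos_norm (smul c x) = cmod c * pos_norm x"
    and pos_norm_triangle: "pos_norm (x + y) \<le> pos_norm x + pos_norm y"
proof -
  have "hilbert_subspace smul ip Fp"
    using decomposition by (simp add: fundamental_decomposition_def)
  note * = component_seminorm[OF direct_sum_Fp_Fm this]
  show "0 \<le> pos_norm x" "pos_norm (smul c x) = cmod c * pos_norm x"
    "pos_norm (x + y) \<le> pos_norm x + pos_norm y"
    unfolding pos_norm_def by (rule *)+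
qed

lemma neg_norm_seminorm:
  shows neg_norm_nonneg: "0 \<le> neg_norm x"
    and neg_norm_scale: "neg_norm (smul c x) = cmod c * neg_norm x"
    and neg_norm_triangle: "neg_norm (x + y) \<le> neg_norm x + neg_norm y"
proof -
  have "hilbert_subspace smul (\<lambda>x y. - ip x y) Fm"
    using decomposition by (simp add: fundamental_decomposition_def)
  note * = indefinite_inner_product_space.component_seminorm
    [OF negated_ip direct_sum_Fm_Fp this]
  show "0 \<le> neg_norm x" "neg_norm (smul c x) = cmod c * neg_norm x"
    "neg_norm (x + y) \<le> neg_norm x + neg_norm y"
    unfolding neg_norm_def by (rule *)+
qed

lemma component_J:
  "component Fp Fm (\<J> x) = component Fp Fm x"
  "component Fm Fp (\<J> x) = - component Fm Fp x"
proof -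
  obtain u w where *: "u \<in> Fp" "w \<in> Fm" "component Fp Fm x = u" "component Fm Fp x = w"
    by (rule direct_sum.component_cases[OF direct_sum_Fp_Fm])
  moreover have "- w \<in> Fm"
    using \<open>w \<in> Fm\<close> direct_sum.subspace_T[OF direct_sum_Fp_Fm] by (rule subspace_neg[rotated])
  moreover have "\<J> x = u + (- w)" "\<J> x = (- w) + u"
    using * by (simp_all add: J_eq fundamental_symmetry_def)
  ultimately show "component Fp Fm (\<J> x) = component Fp Fm x"
    "component Fm Fp (\<J> x) = - component Fm Fp x"
    using direct_sum.component_eqI[OF direct_sum_Fp_Fm] direct_sum.component_eqI[OF direct_sum_Fm_Fp]
    by metis+
qed

lemma J_two_norm_eq:
  "J_two_norm \<psi> \<J> x y = sqrt ((pos_norm x * pos_norm y)\<^sup>2 + (neg_norm x * neg_norm y)\<^sup>2)"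
proof -
  let ?p = "component Fp Fm x" and ?q = "component Fm Fp x"
  \<comment> \<open>As \<open>sqrt\<close> is odd on the reals, nonnegativity of the seminorms forces nonnegative radicands, so
    squaring undoes the roots.\<close>
  have "Re (ip ?p ?p) = (pos_norm x)\<^sup>2" "- Re (ip ?q ?q) = (neg_norm x)\<^sup>2"
    using pos_norm_nonneg[of x] neg_norm_nonneg[of x]
    by (simp_all add: pos_norm_def neg_norm_def ip_norm_def)
  moreover have "\<psi> (\<J> x) x y =
      ip ?p ?p * of_real ((pos_norm y)\<^sup>2) - ip ?q ?q * of_real ((neg_norm y)\<^sup>2)"
    by (simp add: psi_eq standard_two_inner_product_def component_J ip_minus_left
        pos_norm_def neg_norm_def)
  ultimately show ?thesis
    by (simp add: J_two_norm_def power_mult_distrib minus_mult_left[symmetric] flip: of_real_power)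
      (metis add_uminus_conv_diff minus_mult_left)
qed

lemma J_two_norm_nonneg: "0 \<le> J_two_norm \<psi> \<J> x y"
  by (simp add: J_two_norm_eq)

lemma J_two_norm_commute: "J_two_norm \<psi> \<J> x y = J_two_norm \<psi> \<J> y x"
  by (simp add: J_two_norm_eq mult.commute)

lemma J_two_norm_scale_left:
  "J_two_norm \<psi> \<J> (smul c x) y = cmod c * J_two_norm \<psi> \<J> x y"
proof -
  have "(pos_norm (smul c x) * pos_norm y)\<^sup>2 + (neg_norm (smul c x) * neg_norm y)\<^sup>2
      = (cmod c)\<^sup>2 * ((pos_norm x * pos_norm y)\<^sup>2 + (neg_norm x * neg_norm y)\<^sup>2)"
    by (simp add: pos_norm_scale neg_norm_scale power_mult_distrib algebra_simps)
  then show ?thesis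
    by (simp add: J_two_norm_eq real_sqrt_mult)
qed

lemma J_two_norm_triangle_left:
  "J_two_norm \<psi> \<J> (x + x') y \<le> J_two_norm \<psi> \<J> x y + J_two_norm \<psi> \<J> x' y"
proof -
  have "pos_norm (x + x') * pos_norm y \<le> pos_norm x * pos_norm y + pos_norm x' * pos_norm y"
    using mult_right_mono[OF pos_norm_triangle pos_norm_nonneg] by (simp add: distrib_right)
  moreover
  have "neg_norm (x + x') * neg_norm y \<le> neg_norm x * neg_norm y + neg_norm x' * neg_norm y"
    using mult_right_mono[OF neg_norm_triangle neg_norm_nonneg] by (simp add: distrib_right)
  ultimately have "J_two_norm \<psi> \<J> (x + x') y \<le>
      sqrt ((pos_norm x * pos_norm y + pos_norm x' * pos_norm y)\<^sup>2
          + (neg_norm x * neg_norm y + neg_norm x' * neg_norm y)\<^sup>2)"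
    unfolding J_two_norm_eq
    by (intro real_sqrt_le_mono add_mono power_mono mult_nonneg_nonneg
        pos_norm_nonneg neg_norm_nonneg)
  also have "\<dots> \<le> J_two_norm \<psi> \<J> x y + J_two_norm \<psi> \<J> x' y"
    unfolding J_two_norm_eq by (rule real_sqrt_sum_squares_triangle_ineq)
  finally show ?thesis .
qed

lemma J_two_norm_triangle_right:
  "J_two_norm \<psi> \<J> x (y + y') \<le> J_two_norm \<psi> \<J> x y + J_two_norm \<psi> \<J> x y'"
  using J_two_norm_triangle_left by (simp add: J_two_norm_commute[of x])

lemma J_two_norm_le_sum: "J_two_norm \<psi> \<J> x y \<le> pos_norm x * pos_norm y + neg_norm x * neg_norm y"
  unfolding J_two_norm_eq
  by (intro sqrt_sum_squares_le_sum mult_nonneg_nonneg pos_norm_nonneg neg_norm_nonneg)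

section \<open>Properties of the variation\<close>

lemma variation_smul:
  "variation (J_two_norm \<psi> \<J>) a b (\<lambda>s. smul c (f s)) t
     = ennreal (cmod c) * variation (J_two_norm \<psi> \<J>) a b f t"
  by (rule variation_scale) (simp_all add: scale_right_diff_distrib[symmetric] J_two_norm_scale_left)

lemma variation_add:
  "variation (J_two_norm \<psi> \<J>) a b (\<lambda>s. f s + g s) t
     \<le> variation (J_two_norm \<psi> \<J>) a b f t + variation (J_two_norm \<psi> \<J>) a b g t"
  by (rule variation_le_add)
    (simp_all add: add_diff_add J_two_norm_triangle_left J_two_norm_nonneg)

lemma variation_add_direction:
  "variation (J_two_norm \<psi> \<J>) a b f (t + v)
     \<le> variation (J_two_norm \<psi> \<J>) a b f t + variation (J_two_norm \<psi> \<J>) a b f v"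
  by (rule variation_le_add) (simp_all add: J_two_norm_triangle_right J_two_norm_nonneg)

text \<open>
  On the right-hand side the two-norms \<open>\<N>\<^sup>\<plusminus>\<close> are first composed with the projections: off their own
  summand \<open>\<N>\<^sup>\<plusminus>\<close> may be negative, whereas their compositions with the projections are nonnegative
  everywhere.  The variation is unchanged because the projections commute with increments.
\<close>

lemma variation_le_components:
  "variation (J_two_norm \<psi> \<J>) a b f t
     \<le> variation (hilbert_two_norm ip) a b
          (\<lambda>s. component Fp Fm (f s)) (component Fp Fm t)
       + variation (hilbert_two_norm (\<lambda>x y. - ip x y)) a b
          (\<lambda>s. component Fm Fp (f s)) (component Fm Fp t)"
proof -
  have "variation (J_two_norm \<psi> \<J>) a b f t
      \<le> variation (\<lambda>x y. pos_norm x * pos_norm y) a b f t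
        + variation (\<lambda>x y. neg_norm x * neg_norm y) a b f t"
    by (rule variation_le_add)
      (simp_all add: J_two_norm_le_sum pos_norm_nonneg neg_norm_nonneg)
  also have "variation (\<lambda>x y. pos_norm x * pos_norm y) a b f t
      = variation (hilbert_two_norm ip) a b
          (\<lambda>s. component Fp Fm (f s)) (component Fp Fm t)"
    by (simp add: variation_def hilbert_two_norm_def pos_norm_def
        direct_sum.component_diff[OF direct_sum_Fp_Fm])
  also have "variation (\<lambda>x y. neg_norm x * neg_norm y) a b f t
      = variation (hilbert_two_norm (\<lambda>x y. - ip x y)) a b
          (\<lambda>s. component Fm Fp (f s)) (component Fm Fp t)"
    by (simp add: variation_def hilbert_two_norm_def neg_norm_def
        direct_sum.component_diff[OF direct_sum_Fm_Fp])
  finally show ?thesis .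
qed

end

theorem theorem5p4:
  fixes smul :: "complex \<Rightarrow> 'a::ab_group_add \<Rightarrow> 'a"
    and ip :: "'a \<Rightarrow> 'a \<Rightarrow> complex"
    and Fp Fm :: "'a set"
    and \<psi> :: "'a \<Rightarrow> 'a \<Rightarrow> 'a \<Rightarrow> complex"
    and \<J> :: "'a \<Rightarrow> 'a"
    and t v :: 'a
    and a b :: real
    and f g :: "real \<Rightarrow> 'a"
    and \<alpha> :: complex
  assumes "standardized_two_krein_space smul ip Fp Fm \<psi> \<J>"
    and "a \<le> b"
    and "strongly_bounded_variation (J_two_norm \<psi> \<J>) a b f t"
    and "strongly_bounded_variation (J_two_norm \<psi> \<J>) a b g t"
  shows "variation (J_two_norm \<psi> \<J>) a b (\<lambda>s. smul \<alpha> (f s)) t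
           = ennreal (cmod \<alpha>) * variation (J_two_norm \<psi> \<J>) a b f t
      \<and> variation (J_two_norm \<psi> \<J>) a b (\<lambda>s. f s + g s) t
           \<le> variation (J_two_norm \<psi> \<J>) a b f t + variation (J_two_norm \<psi> \<J>) a b g t
      \<and> variation (J_two_norm \<psi> \<J>) a b f (t + v)
           \<le> variation (J_two_norm \<psi> \<J>) a b f t + variation (J_two_norm \<psi> \<J>) a b f v
      \<and> variation (J_two_norm \<psi> \<J>) a b f t
           \<le> variation (hilbert_two_norm ip) a b
                 (\<lambda>s. component Fp Fm (f s)) (component Fp Fm t)
             + variation (hilbert_two_norm (\<lambda>x y. - ip x y)) a b
                 (\<lambda>s. component Fm Fp (f s)) (component Fm Fp t)"
proof -
  interpret standardized_two_krein_space smul ip Fp Fm \<psi> \<J>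
    by fact
  show ?thesis
    by (intro conjI variation_smul variation_add variation_add_direction variation_le_components)
qed

end
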